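(* Let $G$ be a simple graph with $n\geq 2$ vertices and $m$ edges such that $$\sqrt{2n-2m+2\sqrt{2m^{2}+mn(n-1)}}<1+\frac{8m^{2}}{n^{2}(n-1)}+\frac{4m}{n}.$$ Then for every natural number $k\leq n$ in the interval $$\left[\sqrt{2n-2m+2\sqrt{2m^{2}+mn(n-1)}},\; 1+\frac{8m^{2}}{n^{2}(n-1)}+\frac{4m}{n}\right]$$ one has $$S_{k}(G)\leq m+\binom{k+1}{2}.$$
   Context: For a simple graph $G$ on $n$ vertices, the Laplacian matrix is the $n\times n$ matrix $L(G)=D(G)-A(G)$, where $D(G)$ is the diagonal matrix of vertex degrees and $A(G)$ is the adjacency matrix. Its eigenvalues, listed with multiplicity in decreasing order, are the nonnegative reals $\mu_{1}(G)\geq \mu_{2}(G)\geq\cdots\geq\mu_{n}(G)=0$. For $1\leq k\leq n$, $S_{k}(G)=\sum_{i=1}^{k}\mu_{i}(G)$. Brouwer's conjecture for $G$ and $k$ is the inequality $S_{k}(G)\leq m+\binom{k+1}{2}$, where $m$ is the number of edges of $G$. *)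

theory Defs
  imports Complex_Main "Jordan_Normal_Form.Char_Poly"
begin

definition simple_graph :: "'a set \<Rightarrow> 'a set set \<Rightarrow> bool" where
  "simple_graph V E \<longleftrightarrow> finite V \<and> (\<forall>e\<in>E. e \<subseteq> V \<and> card e = 2)"

definition degree_of :: "'a set set \<Rightarrow> 'a \<Rightarrow> nat" where
  "degree_of E v = card {e \<in> E. v \<in> e}"

text \<open>
  Matrices have rows and columns indexed by \<open>{0..<n}\<close>, so the matrices of a graph are taken with
  respect to a list \<open>vs\<close> that enumerates the vertex set without repetition.
\<close>

definition adjacency_mat :: "'a list \<Rightarrow> 'a set set \<Rightarrow> real mat" where
  "adjacency_mat vs E =
     mat (length vs) (length vs) (\<lambda>(i, j). if {vs ! i, vs ! j} \<in> E then 1 else 0)"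

definition degree_mat :: "'a list \<Rightarrow> 'a set set \<Rightarrow> real mat" where
  "degree_mat vs E = mat_diag (length vs) (\<lambda>i. real (degree_of E (vs ! i)))"

definition laplacian_mat :: "'a list \<Rightarrow> 'a set set \<Rightarrow> real mat" where
  "laplacian_mat vs E = degree_mat vs E - adjacency_mat vs E"

text \<open>
  The real eigenvalues of a real matrix, with algebraic multiplicity, in decreasing order. For a
  symmetric matrix of dimension \<open>n\<close> all roots of the characteristic polynomial are real and
  algebraic and geometric multiplicities agree, so this list has length \<open>n\<close>.
\<close>

definition eigenvalues_decreasing :: "real mat \<Rightarrow> real list" where
  "eigenvalues_decreasing A = rev (sorted_list_of_multiset (proots (char_poly A)))"

text \<open>The list positions start at \<open>0\<close>, the indices of the eigenvalues \<open>\<mu>\<close> at \<open>1\<close>.\<close>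

definition laplacian_eigenvalue :: "'a list \<Rightarrow> 'a set set \<Rightarrow> nat \<Rightarrow> real" where
  "laplacian_eigenvalue vs E i = eigenvalues_decreasing (laplacian_mat vs E) ! (i - 1)"

definition laplacian_eigenvalue_sum :: "'a list \<Rightarrow> 'a set set \<Rightarrow> nat \<Rightarrow> real" where
  "laplacian_eigenvalue_sum vs E k = (\<Sum>i = 1..k. laplacian_eigenvalue vs E i)"

end

theory Submission
  imports Defs "Jordan_Normal_Form.Schur_Decomposition"
begin

text \<open>
  The Laplacian is positive semidefinite with trace \<open>2m\<close>, so \<open>S\<^sub>k \<le> 2m\<close> for every \<open>k\<close>.
  Since \<open>2m \<le> n(n - 1)\<close>, the inner square root is at least \<open>2m\<close>, so the lower end of the
  interval forces \<open>k\<^sup>2 \<ge> 2n + 2m \<ge> 2m\<close>; then \<open>2m \<le> m + k(k + 1)/2\<close>.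
\<close>

section \<open>Traces, roots of the characteristic polynomial and splitting over the reals\<close>

text \<open>Cyclicity of the trace: \<open>A = P * B * Q\<close> with \<open>Q * P = 1\<close> has
  the same trace as \<open>Q * (P * B) = B\<close>.\<close>

lemma trace_similar_mat_wit:
  fixes A B :: "'a :: comm_ring_1 mat"
  assumes "similar_mat_wit A B P Q" and "A \<in> carrier_mat n n"
  shows "(\<Sum>i<n. A $$ (i, i)) = (\<Sum>i<n. B $$ (i, i))"
proof -
  have QP: "Q * P = 1\<^sub>m n" and A: "A = P * B * Q"
    and P: "P \<in> carrier_mat n n" and B: "B \<in> carrier_mat n n" and Q: "Q \<in> carrier_mat n n"
    using similar_mat_witD2[OF assms(2,1)] by auto
  have tr_comm: "(\<Sum>i<n. (X * Y) $$ (i, i)) = (\<Sum>i<n. (Y * X) $$ (i, i))"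
    if X: "X \<in> carrier_mat n n" and Y: "Y \<in> carrier_mat n n" for X Y :: "'a mat"
  proof -
    have "(\<Sum>i<n. (X * Y) $$ (i, i)) = (\<Sum>i<n. \<Sum>j<n. X $$ (i, j) * Y $$ (j, i))"
      using X Y by (auto simp: scalar_prod_def atLeast0LessThan intro!: sum.cong)
    also have "\<dots> = (\<Sum>j<n. \<Sum>i<n. Y $$ (j, i) * X $$ (i, j))"
      by (subst sum.swap) (simp add: mult.commute)
    also have "\<dots> = (\<Sum>i<n. (Y * X) $$ (i, i))"
      using X Y by (auto simp: scalar_prod_def atLeast0LessThan intro!: sum.cong)
    finally show ?thesis .
  qed
  have "Q * (P * B) = B"
    using P B Q QP by (simp add: assoc_mult_mat[symmetric, of Q n n P n B n])
  then show ?thesis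
    using tr_comm[of "P * B" Q] P B Q A by simp
qed

text \<open>Schur decomposition provides a matrix similar to \<open>A\<close> with diagonal
  \<open>es\<close>, and similarity preserves the trace.\<close>

lemma trace_eq_sum_list_roots:
  fixes A :: "'a :: conjugatable_ordered_field mat"
  assumes A: "A \<in> carrier_mat n n" and "char_poly A = (\<Prod>e\<leftarrow>es. [:- e, 1:])"
  shows "(\<Sum>i<n. A $$ (i, i)) = sum_list es"
proof -
  obtain B P Q where "schur_decomposition A es = (B, P, Q)"
    by (cases "schur_decomposition A es") auto
  from schur_decomposition[OF assms this]
  have w: "similar_mat_wit A B P Q" and d: "diag_mat B = es" by auto
  have "dim_row B = n" using similar_mat_witD2[OF A w] by auto
  then have "sum_list es = (\<Sum>i<n. B $$ (i, i))"
    unfolding d[symmetric] diag_mat_def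
    by (simp add: interv_sum_list_conv_sum_set_nat atLeast0LessThan)
  then show ?thesis using trace_similar_mat_wit[OF w A] by simp
qed

text \<open>Passes from a factorization to the root multiset that
  \<open>eigenvalues_decreasing\<close> sorts.\<close>

lemma proots_prod_list_linear:
  fixes es :: "'a :: idom list"
  shows "proots (\<Prod>e\<leftarrow>es. [:- e, 1:]) = mset es"
proof (induction es)
  case (Cons e es)
  have "(\<Prod>e\<leftarrow>es. [:- e, 1:]) \<noteq> 0" by (auto simp: prod_list_zero_iff)
  with Cons show ?case by (simp add: proots_mult del: mult_pCons_left)
qed simp

text \<open>Factor over the complex numbers. By hypothesis every root equals its real part, so the
  factorization is the image of a real one, and the coefficientwise embedding of polynomials is
  injective.\<close>

lemma char_poly_splits_over_reals:
  fixes A :: "real mat"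
  assumes A: "A \<in> carrier_mat n n"
    and real: "\<And>z. eigenvalue (map_mat complex_of_real A) z \<Longrightarrow> z \<in> \<real>"
  obtains es where "char_poly A = (\<Prod>e\<leftarrow>es. [:- e, 1:])" and "length es = n"
proof -
  let ?C = "map_mat complex_of_real A"
  interpret h: map_poly_inj_idom_hom complex_of_real ..
  have C: "?C \<in> carrier_mat n n" using A by simp
  obtain zs where zs: "char_poly ?C = (\<Prod>z\<leftarrow>zs. [:- z, 1:])" and len: "length zs = n"
    using char_poly_factorized[OF C] by auto
  have "z \<in> \<real>" if "z \<in> set zs" for z
    using that by (intro real) (auto simp: eigenvalue_root_char_poly[OF C] zs poly_prod_list prod_list_zero_iff)
  then have eq: "map complex_of_real (map Re zs) = zs" by (simp add: map_idI)
  have "map_poly complex_of_real (char_poly A) = char_poly ?C"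
    by (rule of_real_hom.char_poly_hom[OF A, symmetric])
  also have "\<dots> = map_poly complex_of_real (\<Prod>e\<leftarrow>map Re zs. [:- e, 1:])"
    unfolding zs by (subst eq[symmetric]) (simp add: h.hom_prod_list o_def)
  finally have "char_poly A = (\<Prod>e\<leftarrow>map Re zs. [:- e, 1:])" by simp
  then show thesis using that len by (metis length_map)
qed

section \<open>Reality and nonnegativity of the eigenvalues via the quadratic form\<close>

text \<open>For an eigenvector \<open>v\<close>, the form \<open>v* A v\<close> equals
  \<open>z * s\<close> with \<open>s\<close> the squared norm of \<open>v\<close>. Symmetry and zero
  row sums also turn it into the nonnegative sum of squares \<open>q\<close>. Hence
  \<open>z = q / s\<close>.\<close>

lemma eigenvalue_zero_row_sums:
  fixes A :: "real mat"
  assumes A: "A \<in> carrier_mat n n"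
    and sym: "\<And>i j. i < n \<Longrightarrow> j < n \<Longrightarrow> A $$ (i, j) = A $$ (j, i)"
    and nonpos: "\<And>i j. i < n \<Longrightarrow> j < n \<Longrightarrow> i \<noteq> j \<Longrightarrow> A $$ (i, j) \<le> 0"
    and row: "\<And>i. i < n \<Longrightarrow> (\<Sum>j<n. A $$ (i, j)) = 0"
    and ev: "eigenvalue (map_mat complex_of_real A) z"
  shows "z \<in> \<real>" and "Re z \<ge> 0"
proof -
  let ?C = "map_mat complex_of_real A"
  obtain v where v: "v \<in> carrier_vec n" "v \<noteq> 0\<^sub>v n" and Cv: "?C *\<^sub>v v = z \<cdot>\<^sub>v v"
    using ev A by (auto simp: eigenvalue_def eigenvector_def)
  define a where "a i j = complex_of_real (A $$ (i, j))" for i j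
  define s where "s = (\<Sum>i<n. (cmod (v $ i))\<^sup>2)"
  \<comment> \<open>The sum runs over ordered pairs, hence the division by 2. For a Laplacian,
    \<open>q\<close> is the sum of \<open>|v i - v j|^2\<close> over the edges.\<close>
  define q where "q = (\<Sum>i<n. \<Sum>j<n. - (A $$ (i, j)) * (cmod (v $ i - v $ j))\<^sup>2) / 2"
  have row_v: "(\<Sum>j<n. a i j * v $ j) = z * v $ i" if "i < n" for i
  proof -
    have "(?C *\<^sub>v v) $ i = (\<Sum>j<n. a i j * v $ j)"
      using that A v by (auto simp: scalar_prod_def a_def atLeast0LessThan)
    then show ?thesis using that v by (simp add: Cv)
  qed
  have "s > 0"
  proof -
    obtain i where "i < n" "v $ i \<noteq> 0" using v by (metis eq_vecI carrier_vecD index_zero_vec)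
    then show ?thesis unfolding s_def by (intro sum_pos2[of _ i]) auto
  qed
  have "q \<ge> 0"
    unfolding q_def
  proof (intro divide_nonneg_pos sum_nonneg)
    fix i j assume "i \<in> {..<n}" "j \<in> {..<n}"
    then show "0 \<le> - A $$ (i, j) * (cmod (v $ i - v $ j))\<^sup>2"
      \<comment> \<open>A diagonal entry may be positive, but its factor
        \<open>v $ i - v $ i\<close> vanishes.\<close>
      using nonpos[of i j] by (cases "i = j") (auto simp: mult_nonpos_nonneg)
  qed simp
  define T where "T = (\<Sum>i<n. \<Sum>j<n. a i j * (cnj (v $ i) * v $ j))"
  have T1: "T = z * of_real s"
  proof -
    have "T = (\<Sum>i<n. cnj (v $ i) * (\<Sum>j<n. a i j * v $ j))"
      unfolding T_def by (simp add: sum_distrib_left algebra_simps)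
    also have "\<dots> = (\<Sum>i<n. z * (v $ i * cnj (v $ i)))"
      by (intro sum.cong) (auto simp: row_v)
    finally show ?thesis by (simp add: s_def sum_distrib_left complex_norm_square del: of_real_power)
  qed
  have row_a: "(\<Sum>j<n. a i j) = 0" if "i < n" for i
    using row[OF that] unfolding a_def by (metis of_real_sum of_real_0)
  have sym_a: "a i j = a j i" if "i < n" "j < n" for i j
    using sym[OF that] by (simp add: a_def)
  have T2: "T = of_real q"
  proof -
    \<comment> \<open>Expanding the squares gives four sums. The two mixed ones both equal
      \<open>T\<close>, the second after swapping indices. In the two with squared moduli a row sum
      factors out, after a swap in the second, so they vanish. Thus
      \<open>2 * q = 2 * T\<close>.\<close>
    have "of_real (2 * q) = (\<Sum>i<n. \<Sum>j<n. - a i j * ((v $ i - v $ j) * cnj (v $ i - v $ j)))"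
      by (simp add: q_def a_def complex_norm_square del: of_real_power)
    also have "\<dots> = (\<Sum>i<n. \<Sum>j<n. a i j * (cnj (v $ i) * v $ j)) + (\<Sum>i<n. \<Sum>j<n. a i j * (cnj (v $ j) * v $ i))
        - (\<Sum>i<n. \<Sum>j<n. a i j * (v $ i * cnj (v $ i))) - (\<Sum>i<n. \<Sum>j<n. a i j * (v $ j * cnj (v $ j)))"
      unfolding sum.distrib[symmetric] sum_subtractf[symmetric]
      by (intro sum.cong refl) (simp add: algebra_simps)
    also have "(\<Sum>i<n. \<Sum>j<n. a i j * (v $ i * cnj (v $ i))) = 0"
      by (simp add: row_a flip: sum_distrib_right)
    also have "(\<Sum>i<n. \<Sum>j<n. a i j * (v $ j * cnj (v $ j))) = (\<Sum>j<n. \<Sum>i<n. a j i * (v $ j * cnj (v $ j)))"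
      by (subst sum.swap) (intro sum.cong refl, simp add: sym_a)
    also have "\<dots> = 0"
      by (simp add: row_a flip: sum_distrib_right)
    also have "(\<Sum>i<n. \<Sum>j<n. a i j * (cnj (v $ j) * v $ i)) = T"
      unfolding T_def by (subst sum.swap) (intro sum.cong refl, simp add: sym_a)
    finally show ?thesis by (simp add: T_def[symmetric])
  qed
  have "z = of_real (q / s)"
    using T1 T2 \<open>s > 0\<close> by (simp add: field_simps)
  then show "z \<in> \<real>" "Re z \<ge> 0" using \<open>q \<ge> 0\<close> \<open>s > 0\<close> by (simp_all del: of_real_divide)
qed

section \<open>Counting edges and degrees\<close>

lemma degree_eq_sum_adjacency:
  assumes "simple_graph (set vs) E" "distinct vs" "i < length vs"
  shows "real (degree_of E (vs ! i)) = (\<Sum>j<length vs. if {vs ! i, vs ! j} \<in> E then 1 else 0)"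
proof -
  let ?J = "{j. j < length vs \<and> {vs ! i, vs ! j} \<in> E}"
  have E: "e \<subseteq> set vs" "card e = 2" if "e \<in> E" for e
    using assms that by (auto simp: simple_graph_def)
  \<comment> \<open>An edge at \<open>vs ! i\<close> is determined by the index of its other end.
    The index \<open>j = i\<close> is not in \<open>?J\<close>, since a singleton is no
    edge.\<close>
  have "bij_betw (\<lambda>j. {vs ! i, vs ! j}) ?J {e \<in> E. vs ! i \<in> e}"
  proof (rule bij_betwI')
    fix x y assume "x \<in> ?J" "y \<in> ?J"
    then show "({vs ! i, vs ! x} = {vs ! i, vs ! y}) = (x = y)"
      using nth_eq_iff_index_eq[OF assms(2)] by (auto simp: doubleton_eq_iff)
  next
    fix e assume e: "e \<in> {e \<in> E. vs ! i \<in> e}"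
    then obtain w where w: "e = {vs ! i, w}"
      using E(2)[of e] by (auto simp: card_2_iff)
    then obtain j where "j < length vs" "vs ! j = w"
      using E(1)[of e] e by (auto simp: in_set_conv_nth)
    with e w show "\<exists>j\<in>?J. e = {vs ! i, vs ! j}" by auto
  qed auto
  then have "degree_of E (vs ! i) = card ?J"
    by (simp add: degree_of_def bij_betw_same_card)
  also have "real (card ?J) = (\<Sum>j<length vs. if {vs ! i, vs ! j} \<in> E then 1 else 0)"
    by (subst sum.inter_filter[symmetric]) (simp_all add: lessThan_def)
  finally show ?thesis .
qed

lemma simple_graph_finite_edges: "simple_graph V E \<Longrightarrow> finite E"
  by (rule finite_subset[of _ "Pow V"]) (auto simp: simple_graph_def)

text \<open>Double counting of incidences: each edge contains exactly two vertices.\<close>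

lemma sum_degree_of:
  assumes "simple_graph V E"
  shows "(\<Sum>v\<in>V. degree_of E v) = 2 * card E"
  unfolding degree_of_def
proof (rule sum_multicount)
  show "\<forall>e\<in>E. card {v \<in> V. v \<in> e} = 2"
  proof
    fix e assume "e \<in> E"
    with assms have "{v \<in> V. v \<in> e} = e" "card e = 2" by (auto simp: simple_graph_def)
    then show "card {v \<in> V. v \<in> e} = 2" by simp
  qed
qed (use assms simple_graph_finite_edges in \<open>auto simp: simple_graph_def\<close>)

lemma card_edges_le:
  assumes "simple_graph V E"
  shows "card E \<le> card V choose 2"
proof -
  have "finite V" using assms by (simp add: simple_graph_def)
  then have "card E \<le> card {e. e \<subseteq> V \<and> card e = 2}"
    using assms by (intro card_mono) (auto simp: simple_graph_def)
  then show ?thesis using n_subsets[OF \<open>finite V\<close>] by simp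
qed

section \<open>The spectrum of the Laplacian\<close>

lemma laplacian_mat_index:
  assumes "i < length vs" "j < length vs"
  shows "laplacian_mat vs E $$ (i, j) =
    (if i = j then real (degree_of E (vs ! i)) else 0) - (if {vs ! i, vs ! j} \<in> E then 1 else 0)"
  using assms by (auto simp: laplacian_mat_def degree_mat_def adjacency_mat_def mat_diag_def)

lemma laplacian_mat_carrier [simp]: "laplacian_mat vs E \<in> carrier_mat (length vs) (length vs)"
  by (intro carrier_matI) (simp_all add: laplacian_mat_def degree_mat_def adjacency_mat_def mat_diag_def)

text \<open>The degree on the diagonal cancels the adjacency entries of its row, so the quadratic
  form argument applies. The sum of the eigenvalues is the trace, which is the degree sum.\<close>

lemma laplacian_eigenvalues:
  fixes vs :: "'a list" and E :: "'a set set"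
  defines "mus \<equiv> eigenvalues_decreasing (laplacian_mat vs E)"
  assumes G: "simple_graph (set vs) E" and dist: "distinct vs"
  shows "length mus = length vs" and "\<And>x. x \<in> set mus \<Longrightarrow> x \<ge> 0"
    and "sum_list mus = 2 * real (card E)"
proof -
  let ?n = "length vs" and ?L = "laplacian_mat vs E"
  let ?C = "map_mat complex_of_real ?L"
  have row: "(\<Sum>j<?n. ?L $$ (i, j)) = 0" if "i < ?n" for i
    using that degree_eq_sum_adjacency[OF G dist that]
    by (simp add: laplacian_mat_index sum_subtractf)
  have sym: "?L $$ (i, j) = ?L $$ (j, i)" if "i < ?n" "j < ?n" for i j
    using that by (auto simp: laplacian_mat_index insert_commute[of "vs ! i"])
  have nonpos: "?L $$ (i, j) \<le> 0" if "i < ?n" "j < ?n" "i \<noteq> j" for i j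
    using that by (simp add: laplacian_mat_index)
  have ev: "z \<in> \<real>" "Re z \<ge> 0" if "eigenvalue ?C z" for z
    by (rule eigenvalue_zero_row_sums[OF laplacian_mat_carrier sym nonpos row that]; assumption)+
  obtain es where es: "char_poly ?L = (\<Prod>e\<leftarrow>es. [:- e, 1:])" and len: "length es = ?n"
    using char_poly_splits_over_reals[OF laplacian_mat_carrier ev(1)] by blast
  have mus: "mset mus = mset es"
    by (simp add: mus_def eigenvalues_decreasing_def es proots_prod_list_linear)
  show "length mus = ?n" using len mset_eq_length[OF mus] by simp
  show "x \<ge> 0" if "x \<in> set mus" for x
  proof -
    have "x \<in> set es" using that mset_eq_setD[OF mus] by simp
    then have "eigenvalue ?L x"
      by (auto simp: eigenvalue_root_char_poly[OF laplacian_mat_carrier] es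
          poly_prod_list prod_list_zero_iff)
    \<comment> \<open>The sign is known for eigenvalues of the complexified matrix, so
      \<open>x\<close> is carried there.\<close>
    then have "eigenvalue ?C (of_real x)"
      by (rule of_real_hom.eigenvalue_hom[OF laplacian_mat_carrier])
    then show ?thesis using ev(2) by fastforce
  qed
  \<comment> \<open>Without loops the adjacency part has zero diagonal, so the diagonal entries of
    \<open>?L\<close> are the degrees.\<close>
  have loop: "{v} \<notin> E" for v using G by (auto simp: simple_graph_def)
  have "sum_list mus = sum_list es" using mus by (metis sum_mset_sum_list)
  also have "\<dots> = (\<Sum>i<?n. ?L $$ (i, i))"
    by (rule trace_eq_sum_list_roots[OF laplacian_mat_carrier es, symmetric])
  also have "\<dots> = real (\<Sum>i<?n. degree_of E (vs ! i))"
    by (simp add: laplacian_mat_index loop)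
  also have "(\<Sum>i<?n. degree_of E (vs ! i)) = (\<Sum>v\<in>set vs. degree_of E v)"
    using sum.reindex_bij_betw[OF bij_betw_nth[OF dist refl refl]] .
  finally show "sum_list mus = 2 * real (card E)" by (simp add: sum_degree_of[OF G])
qed

text \<open>Extending the partial sum to all eigenvalues adds only nonnegative terms and reaches the
  trace.\<close>

lemma laplacian_eigenvalue_sum_le:
  assumes "simple_graph (set vs) E" "distinct vs" "k \<le> length vs"
  shows "laplacian_eigenvalue_sum vs E k \<le> 2 * real (card E)"
proof -
  let ?mus = "eigenvalues_decreasing (laplacian_mat vs E)"
  note mus = laplacian_eigenvalues[OF assms(1,2)]
  have "laplacian_eigenvalue_sum vs E k = (\<Sum>i<k. ?mus ! i)"
    unfolding laplacian_eigenvalue_sum_def laplacian_eigenvalue_def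
    \<comment> \<open>Shifts the eigenvalue indices \<open>1..k\<close> to list positions
      \<open>0..k-1\<close>.\<close>
    by (rule sum.reindex_bij_witness[of _ Suc "\<lambda>i. i - 1"]) auto
  also have "\<dots> \<le> (\<Sum>i<length ?mus. ?mus ! i)"
    using assms(3) mus(1) by (intro sum_mono2) (auto intro!: mus(2))
  also have "\<dots> = 2 * real (card E)"
    using mus(3) by (simp add: sum_list_sum_nth atLeast0LessThan)
  finally show ?thesis .
qed

theorem theorem7:
  fixes V :: "'a set" and E :: "'a set set" and vs :: "'a list" and n m :: nat
  assumes "simple_graph V E"
    and "distinct vs" and "set vs = V"
    and "n = card V" and "m = card E"
    and "n \<ge> 2"
    and "sqrt (2 * real n - 2 * real m
            + 2 * sqrt (2 * (real m)\<^sup>2 + real m * real n * (real n - 1)))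
         < 1 + 8 * (real m)\<^sup>2 / ((real n)\<^sup>2 * (real n - 1)) + 4 * real m / real n"
  shows "\<forall>k::nat. k \<le> n \<and>
           real k \<in> {sqrt (2 * real n - 2 * real m
                       + 2 * sqrt (2 * (real m)\<^sup>2 + real m * real n * (real n - 1)))
                     .. 1 + 8 * (real m)\<^sup>2 / ((real n)\<^sup>2 * (real n - 1)) + 4 * real m / real n}
           \<longrightarrow> laplacian_eigenvalue_sum vs E k \<le> real m + real ((k + 1) choose 2)"
proof (intro allI impI)
  let ?r = "sqrt (2 * (real m)\<^sup>2 + real m * real n * (real n - 1))"
  fix k :: nat
  assume k: "k \<le> n \<and> real k \<in> {sqrt (2 * real n - 2 * real m + 2 * ?r)
    .. 1 + 8 * (real m)\<^sup>2 / ((real n)\<^sup>2 * (real n - 1)) + 4 * real m / real n}"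
  \<comment> \<open>Used at \<open>j = n - 1\<close> to bound the number of edges and at
    \<open>j = k\<close> for the target.\<close>
  have choose: "2 * real (Suc j choose 2) = real j * (real j + 1)" for j
    by (induction j) (simp_all add: numeral_2_eq_2 algebra_simps)
  have "length vs = n" using assms(2-4) distinct_card[of vs] by simp
  then have S: "laplacian_eigenvalue_sum vs E k \<le> 2 * real m"
    using laplacian_eigenvalue_sum_le[of vs E k] assms(1-3,5) k by simp
  have "real m \<le> real (n choose 2)"
    using card_edges_le[OF assms(1)] assms(4,5) by simp
  then have "2 * real m \<le> real n * (real n - 1)"
    using choose[of "n - 1"] \<open>n \<ge> 2\<close> by (simp add: of_nat_diff algebra_simps)
  then have "real m * (2 * real m) \<le> real m * (real n * (real n - 1))"
    by (rule mult_left_mono) simp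
  \<comment> \<open>Split \<open>(2m)^2\<close> as \<open>2m^2 + m * 2m\<close> and bound the second
    summand by \<open>m * n * (n - 1)\<close>.\<close>
  then have "2 * real m \<le> ?r"
    by (intro real_le_rsqrt) (simp add: power2_eq_square algebra_simps)
  \<comment> \<open>The lower end of the interval, squared.\<close>
  moreover have "2 * real n - 2 * real m + 2 * ?r \<le> (real k)\<^sup>2"
    using k by (intro sqrt_le_D) simp
  ultimately have "2 * real m \<le> (real k)\<^sup>2" by linarith
  \<comment> \<open>Here \<open>2m \<le> k^2 \<le> k * (k + 1)\<close>; this pays for one of the two
    copies of \<open>m\<close> in the bound on the eigenvalue sum.\<close>
  then have "real m \<le> real ((k + 1) choose 2)"
    using choose[of k] by (simp add: power2_eq_square algebra_simps)
  with S show "laplacian_eigenvalue_sum vs E k \<le> real m + real ((k + 1) choose 2)" by linarith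
qed

end
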